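(* Let $k\geq 1$ and $d\geq 1$ be integers and let $c$ be an integer with $c\geq (2k-1)\lceil d/2\rceil+1$. If $D$ is a $c$-edge-connected directed graph with diameter $d$, then $D$ is $k$-edge-ordered.
   Context: Directed graphs are finite, without loops or multiple arcs. The diameter is the maximum, over ordered pairs $(u,v)$ of vertices, of the length of a shortest directed path from $u$ to $v$. An edge cut of $D$ is the set $[S,\bar S]$ of arcs from $S$ to its complement $\bar S$, for a nonempty proper subset $S$ of the vertices; $D$ is $c$-edge-connected if every edge cut has at least $c$ arcs. A directed tour is a closed directed walk with no repeated arcs. $D$ is $k$-edge-ordered if for every sequence $e_1,\ldots,e_k$ of $k$ distinct arcs of $D$ there is a directed tour containing $e_1,\ldots,e_k$ in this (cyclic) order. *)

theory Defs
  imports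
    "Graph_Theory.Arc_Walk"
    "HOL-Library.Extended_Nat"
    "HOL-Library.Sublist"
begin

text \<open>
  Finite directed graphs without loops or multiple arcs are the locale \<open>digraph\<close>;
  directed paths are \<open>apath\<close>, whose length is the number of arcs.
\<close>

context pre_digraph
begin

text \<open>The distance is \<open>\<infinity>\<close> if there is no directed path from \<open>u\<close> to \<open>v\<close>.\<close>

definition distance :: "'a \<Rightarrow> 'a \<Rightarrow> enat" where
  "distance u v = (INF p \<in> {p. apath u p v}. enat (length p))"

text \<open>
  For a finite nonempty vertex set the supremum is a maximum; it is \<open>\<infinity>\<close> unless the
  digraph is strongly connected.  For the empty digraph it is \<open>0\<close>.
\<close>

definition diameter :: enat where
  "diameter = (SUP (u, v) \<in> verts G \<times> verts G. distance u v)"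

definition edge_cut :: "'a set \<Rightarrow> 'b set" where
  "edge_cut S = {e \<in> arcs G. tail G e \<in> S \<and> head G e \<in> verts G - S}"

definition edge_connected :: "nat \<Rightarrow> bool" where
  "edge_connected c \<longleftrightarrow> (\<forall>S. S \<noteq> {} \<and> S \<subset> verts G \<longrightarrow> c \<le> card (edge_cut S))"

definition tour :: "'b awalk \<Rightarrow> bool" where
  "tour p \<longleftrightarrow> (\<exists>u. trail u p u)"

text \<open>
  A tour has no distinguished starting vertex, so the prescribed arcs have to occur as a
  (not necessarily contiguous) subsequence of some rotation of its arc list.
\<close>

definition edge_ordered :: "nat \<Rightarrow> bool" where
  "edge_ordered k \<longleftrightarrow>
     (\<forall>es. length es = k \<and> distinct es \<and> set es \<subseteq> arcs G \<longrightarrow>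
        (\<exists>p. tour p \<and> (\<exists>r. subseq es (rotate r p))))"

end

end

theory Submission
  imports Defs "HOL-Library.Disjoint_Sets"
begin

text \<open>
  Since \<open>c \<ge> 2 * k\<close>, deleting the \<open>k\<close> prescribed arcs leaves a \<open>k\<close>-edge-connected digraph.
  Such a digraph is weakly \<open>k\<close>-linked (Shiloach): by Edmonds' branching theorem there are \<open>k\<close>
  arc-disjoint spanning branchings with arbitrarily prescribed roots, and the branching rooted at
  the head of one prescribed arc contains a path to the tail of the next one.  Edmonds' theorem is
  proved by Lovasz' uncrossing argument, in the form where each branching grows from a prescribed
  set of vertices.
\<close>

lemma disjoint_family_on_fun_upd_insert:
  assumes "disjoint_family_on F I" "\<And>i. i \<in> I \<Longrightarrow> x \<notin> F i"
  shows "disjoint_family_on (F(j := insert x (F j))) I"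
proof (rule disjoint_family_on_bisimulation[OF assms(1)])
  fix m n assume "m \<in> I" "n \<in> I" "m \<noteq> n" "F m \<inter> F n = {}"
  then show "(F(j := insert x (F j))) m \<inter> (F(j := insert x (F j))) n = {}"
    using assms(2)[of m] assms(2)[of n] by auto
qed

lemma subseq_map_concat_map:
  assumes "\<And>x. x \<in> set xs \<Longrightarrow> f x \<in> set (g x)"
  shows "subseq (map f xs) (concat (map g xs))"
  using assms
proof (induction xs)
  case (Cons x xs)
  have "subseq ([f x] @ map f xs) (g x @ concat (map g xs))"
    using Cons by (intro list_emb_append_mono) (auto simp: subseq_singleton_left)
  then show ?case
    by simp
qed simp

definition missed :: "'i set \<Rightarrow> ('i \<Rightarrow> 'a set) \<Rightarrow> 'a set \<Rightarrow> 'i set" where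
  "missed I R X = {i \<in> I. R i \<inter> X = {}}"

lemma finite_missed: "finite I \<Longrightarrow> finite (missed I R X)"
  by (simp add: missed_def)

lemma missed_antimono: "X \<subseteq> Y \<Longrightarrow> missed I R Y \<subseteq> missed I R X"
  by (auto simp: missed_def)

lemma missed_Un: "missed I R (X \<union> Y) = missed I R X \<inter> missed I R Y"
  by (auto simp: missed_def)

lemma missed_insert_root:
  "missed I (R(j := insert v (R j))) X = missed I R X - (if v \<in> X then {j} else {})"
  by (auto simp: missed_def split: if_splits)

context pre_digraph
begin

definition entering :: "'b set \<Rightarrow> 'a set \<Rightarrow> 'b set" where
  "entering A X = {e \<in> A. tail G e \<notin> X \<and> head G e \<in> X}"

lemma finite_entering: "finite A \<Longrightarrow> finite (entering A X)"
  by (simp add: entering_def)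

lemma entering_Diff: "entering (A - B) X = entering A X - B"
  by (auto simp: entering_def)

lemma card_entering_submodular:
  assumes "finite A"
  shows "card (entering A (X \<inter> Y)) + card (entering A (X \<union> Y))
    \<le> card (entering A X) + card (entering A Y)"
proof -
  note card_Un_Int_entering = card_Un_Int[OF finite_entering[OF assms] finite_entering[OF assms]]
  have "card (entering A (X \<inter> Y) \<union> entering A (X \<union> Y)) \<le> card (entering A X \<union> entering A Y)"
    by (rule card_mono) (auto simp: entering_def assms)
  moreover have "card (entering A (X \<inter> Y) \<inter> entering A (X \<union> Y))
      \<le> card (entering A X \<inter> entering A Y)"
    by (rule card_mono) (auto simp: entering_def assms)
  ultimately show ?thesis
    by (simp only: card_Un_Int_entering add_mono)
qed

definition cut_condition :: "'b set \<Rightarrow> 'i set \<Rightarrow> ('i \<Rightarrow> 'a set) \<Rightarrow> bool" where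
  "cut_condition A I R \<longleftrightarrow>
     (\<forall>X. X \<noteq> {} \<and> X \<subseteq> verts G \<longrightarrow> card (missed I R X) \<le> card (entering A X))"

lemma cut_conditionD:
  "cut_condition A I R \<Longrightarrow> X \<noteq> {} \<Longrightarrow> X \<subseteq> verts G
    \<Longrightarrow> card (missed I R X) \<le> card (entering A X)"
  by (simp add: cut_condition_def)

lemma cut_condition_singleton_roots:
  assumes "finite I" "s ` I \<subseteq> verts G"
    and "\<And>X. X \<noteq> {} \<Longrightarrow> X \<subset> verts G \<Longrightarrow> card I \<le> card (entering A X)"
  shows "cut_condition A I (\<lambda>i. {s i})"
  unfolding cut_condition_def
proof (intro allI impI, elim conjE)
  fix X assume X: "X \<noteq> {}" "X \<subseteq> verts G"
  show "card (missed I (\<lambda>i. {s i}) X) \<le> card (entering A X)"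
  proof (cases "X = verts G")
    case True
    then have "missed I (\<lambda>i. {s i}) X = {}"
      using assms(2) by (auto simp: missed_def)
    then show ?thesis
      by simp
  next
    case False
    have "card (missed I (\<lambda>i. {s i}) X) \<le> card I"
      using \<open>finite I\<close> by (intro card_mono) (auto simp: missed_def)
    also have "\<dots> \<le> card (entering A X)"
      using assms(3) X False by blast
    finally show ?thesis .
  qed
qed

definition tight :: "'b set \<Rightarrow> 'i set \<Rightarrow> ('i \<Rightarrow> 'a set) \<Rightarrow> 'a set \<Rightarrow> bool" where
  "tight A I R X \<longleftrightarrow> card (missed I R X) = card (entering A X)"

lemma tight_Int:
  assumes "finite I" "finite A" "cut_condition A I R"
    and "X \<subseteq> verts G" "Y \<subseteq> verts G" "X \<inter> Y \<noteq> {}" "tight A I R X" "tight A I R Y"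
  shows "tight A I R (X \<inter> Y)" and "missed I R (X \<inter> Y) = missed I R X \<union> missed I R Y"
proof -
  note fin = finite_missed[OF \<open>finite I\<close>]
  have missed_Un_subset: "missed I R X \<union> missed I R Y \<subseteq> missed I R (X \<inter> Y)"
    by (simp add: missed_antimono)
  have cut_Int: "card (missed I R (X \<inter> Y)) \<le> card (entering A (X \<inter> Y))"
    and cut_Un: "card (missed I R (X \<union> Y)) \<le> card (entering A (X \<union> Y))"
    using assms by (auto intro!: cut_conditionD)
  have "card (entering A (X \<inter> Y)) + card (entering A (X \<union> Y))
      \<le> card (missed I R X) + card (missed I R Y)"
    using card_entering_submodular[OF \<open>finite A\<close>] \<open>tight A I R X\<close> \<open>tight A I R Y\<close>
    by (simp add: tight_def)
  also have "\<dots> = card (missed I R X \<union> missed I R Y) + card (missed I R (X \<union> Y))"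
    by (simp only: missed_Un card_Un_Int[OF fin fin])
  finally have entering_le: "card (entering A (X \<inter> Y)) \<le> card (missed I R X \<union> missed I R Y)"
    using cut_Un by linarith
  then have "card (missed I R (X \<inter> Y)) \<le> card (missed I R X \<union> missed I R Y)"
    using cut_Int by linarith
  then show missed_eq: "missed I R (X \<inter> Y) = missed I R X \<union> missed I R Y"
    using card_seteq[OF fin missed_Un_subset] by simp
  show "tight A I R (X \<inter> Y)"
    using cut_Int entering_le by (simp add: tight_def missed_eq)
qed

lemma tight_imp_arc_leaving_root:
  assumes "finite I" "finite A" "cut_condition A I R" "j \<in> I"
    and "X \<subseteq> verts G" "tight A I R X" "X \<inter> R j \<noteq> {}" "X - R j \<noteq> {}"
  obtains e where "e \<in> A" "tail G e \<in> X \<inter> R j" "head G e \<in> X - R j"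
proof -
  have "j \<in> missed I R (X - R j)" "j \<notin> missed I R X"
    using \<open>j \<in> I\<close> \<open>X \<inter> R j \<noteq> {}\<close> by (auto simp: missed_def)
  then have "missed I R X \<subset> missed I R (X - R j)"
    using missed_antimono[of "X - R j" X I R] by blast
  then have "card (missed I R X) < card (missed I R (X - R j))"
    by (rule psubset_card_mono[OF finite_missed[OF \<open>finite I\<close>]])
  also have "\<dots> \<le> card (entering A (X - R j))"
    using assms by (intro cut_conditionD) auto
  finally have "card (entering A X) < card (entering A (X - R j))"
    using \<open>tight A I R X\<close> by (simp add: tight_def)
  then have "\<not> entering A (X - R j) \<subseteq> entering A X"
    using card_mono[OF finite_entering[OF \<open>finite A\<close>]] by (meson not_le)
  then show ?thesis
    using that by (auto simp: entering_def)
qed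

lemma cut_condition_insert_head:
  assumes "finite I" "finite A" "cut_condition A I R" "j \<in> I"
    and not_tight: "\<And>X. X \<subseteq> verts G \<Longrightarrow> e \<in> entering A X \<Longrightarrow> X \<inter> R j \<noteq> {} \<Longrightarrow> \<not> tight A I R X"
  shows "cut_condition (A - {e}) I (R(j := insert (head G e) (R j)))"
  unfolding cut_condition_def
proof (intro allI impI, elim conjE)
  fix X assume X: "X \<noteq> {}" "X \<subseteq> verts G"
  note cut = cut_conditionD[OF \<open>cut_condition A I R\<close> X]
  have fin_missed: "finite (missed I R X)" and fin_entering: "finite (entering A X)"
    using assms(1,2) by (simp_all add: finite_missed finite_entering)
  show "card (missed I (R(j := insert (head G e) (R j))) X) \<le> card (entering (A - {e}) X)"
  proof (cases "e \<in> entering A X")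
    case False
    have "card (missed I (R(j := insert (head G e) (R j))) X) \<le> card (missed I R X)"
      by (rule card_mono[OF fin_missed]) (auto simp: missed_insert_root)
    then show ?thesis
      using False cut by (simp add: entering_Diff)
  next
    case True
    then have missed_eq: "missed I (R(j := insert (head G e) (R j))) X = missed I R X - {j}"
      by (simp add: missed_insert_root entering_def)
    have card_entering_eq: "card (entering (A - {e}) X) = card (entering A X) - 1"
      using True fin_entering by (simp add: entering_Diff)
    show ?thesis
    proof (cases "X \<inter> R j = {}")
      case True
      then have "j \<in> missed I R X"
        using \<open>j \<in> I\<close> by (auto simp: missed_def)
      then show ?thesis
        using cut fin_missed by (simp add: missed_eq card_entering_eq diff_le_mono)
    next
      case False
      then have "card (missed I R X) < card (entering A X)"
        using not_tight[OF X(2) True] cut by (simp add: tight_def)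
      moreover have "card (missed I R X - {j}) \<le> card (missed I R X)"
        by (rule card_Diff1_le)
      ultimately show ?thesis
        by (simp add: missed_eq card_entering_eq)
    qed
  qed
qed

text \<open>Equivalently, \<open>B\<close> contains a spanning branching with root set \<open>S \<inter> verts G\<close>.\<close>

definition spans_from :: "'b set \<Rightarrow> 'a set \<Rightarrow> bool" where
  "spans_from B S \<longleftrightarrow> (\<forall>v\<in>verts G. \<exists>u\<in>S. \<exists>p. awalk u p v \<and> set p \<subseteq> B)"

definition arc_disjoint_trails ::
  "'b set \<Rightarrow> 'i set \<Rightarrow> ('i \<Rightarrow> 'a) \<Rightarrow> ('i \<Rightarrow> 'a) \<Rightarrow> ('i \<Rightarrow> 'b awalk) \<Rightarrow> bool" where
  "arc_disjoint_trails A I s t P \<longleftrightarrow>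
     (\<forall>i\<in>I. trail (s i) (P i) (t i) \<and> set (P i) \<subseteq> A) \<and> disjoint_family_on (\<lambda>i. set (P i)) I"

end

context wf_digraph
begin

lemma entering_verts: "A \<subseteq> arcs G \<Longrightarrow> entering A (verts G) = {}"
  by (auto simp: entering_def)

lemma card_entering_Diff_ge:
  assumes "edge_connected c" "finite B" "X \<noteq> {}" "X \<subset> verts G"
  shows "c - card B \<le> card (entering (arcs G - B) X)"
proof -
  have "verts G - X \<noteq> {}" "verts G - X \<subset> verts G"
    using \<open>X \<noteq> {}\<close> \<open>X \<subset> verts G\<close> by auto
  then have "c \<le> card (edge_cut (verts G - X))"
    using \<open>edge_connected c\<close> by (simp add: edge_connected_def)
  then have "c - card B \<le> card (edge_cut (verts G - X)) - card B"
    by (rule diff_le_mono)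
  also have "\<dots> \<le> card (edge_cut (verts G - X) - B)"
    by (rule diff_card_le_card_Diff[OF \<open>finite B\<close>])
  also have "edge_cut (verts G - X) - B = entering (arcs G - B) X"
    using \<open>X \<subset> verts G\<close> by (auto simp: edge_cut_def entering_def)
  finally show ?thesis .
qed

lemma missed_verts_empty:
  assumes "finite I" "A \<subseteq> arcs G" "cut_condition A I R" "verts G \<noteq> {}"
  shows "missed I R (verts G) = {}"
proof -
  have "card (missed I R (verts G)) \<le> card (entering A (verts G))"
    using assms by (intro cut_conditionD) auto
  then show ?thesis
    by (simp add: entering_verts[OF \<open>A \<subseteq> arcs G\<close>] finite_missed[OF \<open>finite I\<close>])
qed

lemma tight_verts:
  assumes "finite I" "A \<subseteq> arcs G" "cut_condition A I R" "verts G \<noteq> {}"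
  shows "tight A I R (verts G)"
  by (simp add: tight_def missed_verts_empty[OF assms] entering_verts[OF \<open>A \<subseteq> arcs G\<close>])

lemma spans_from_verts: "verts G \<subseteq> S \<Longrightarrow> spans_from B S"
  unfolding spans_from_def by (metis awalk_Nil_iff empty_subsetI list.set(1) subsetD)

lemma spans_from_insert_head:
  assumes "spans_from B (insert (head G e) S)" "e \<in> arcs G" "tail G e \<in> S"
  shows "spans_from (insert e B) S"
  unfolding spans_from_def
proof
  fix v assume "v \<in> verts G"
  then obtain u p where p: "u \<in> insert (head G e) S" "awalk u p v" "set p \<subseteq> B"
    using assms(1) unfolding spans_from_def by blast
  show "\<exists>u\<in>S. \<exists>p. awalk u p v \<and> set p \<subseteq> insert e B"
  proof (cases "u \<in> S")
    case True
    then show ?thesis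
      using p by blast
  next
    case False
    then have "awalk (tail G e) (e # p) v" "set (e # p) \<subseteq> insert e B"
      using p assms(2) by (auto simp: awalk_Cons_iff)
    then show ?thesis
      using \<open>tail G e \<in> S\<close> by blast
  qed
qed

lemma awalk_imp_trail:
  assumes "awalk u p v"
  obtains q where "trail u q v" "set q \<subseteq> set p"
proof
  show "trail u (awalk_to_apath p) v"
    using apath_awalk_to_apath[OF assms] distinct_verts_imp_distinct
    by (auto simp: apath_def trail_def)
  show "set (awalk_to_apath p) \<subseteq> set p"
    by (rule awalk_to_apath_subset[OF assms])
qed

lemma trail_concat:
  assumes "\<And>i. i < n \<Longrightarrow> trail (u i) (Q i) (u (Suc i))"
    and "disjoint_family_on (\<lambda>i. set (Q i)) {..<n}" "u 0 \<in> verts G"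
  shows "trail (u 0) (concat (map Q [0..<n])) (u n)"
  using assms
proof (induction n)
  case 0
  then show ?case
    by (simp add: trail_Nil_iff)
next
  case (Suc n)
  have "disjoint_family_on (\<lambda>i. set (Q i)) {..<n}"
    and disj: "set (Q n) \<inter> (\<Union>i<n. set (Q i)) = {}"
    using Suc.prems(2) by (simp_all add: lessThan_Suc disjoint_family_on_insert)
  then have "trail (u 0) (concat (map Q [0..<n])) (u n)"
    using Suc by simp
  moreover have "trail (u n) (Q n) (u (Suc n))"
    using Suc.prems(1) by simp
  moreover have "set (concat (map Q [0..<n])) \<inter> set (Q n) = {}"
    using disj by (simp add: Int_commute lessThan_atLeast0)
  ultimately show ?case
    by (auto simp: trail_def)
qed

lemma tour_through_arcs:
  assumes es: "es \<noteq> []" "distinct es" "set es \<subseteq> arcs G"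
    and P: "arc_disjoint_trails (arcs G - set es) {..<length es}
      (\<lambda>i. head G (es ! i)) (\<lambda>i. tail G (es ! (Suc i mod length es))) P"
  shows "\<exists>p. tour p \<and> subseq es p"
proof -
  define u where "u i = tail G (es ! (i mod length es))" for i
  define Q where "Q i = es ! i # P i" for i
  have arc_nth: "es ! i \<in> arcs G" if "i < length es" for i
    using nth_mem[OF that] es(3) by blast
  have P_trail: "trail (head G (es ! i)) (P i) (u (Suc i))"
    and P_avoids: "set (P i) \<inter> set es = {}" if "i < length es" for i
    using P that by (auto simp: arc_disjoint_trails_def u_def)
  have Q_trail: "trail (u i) (Q i) (u (Suc i))" if "i < length es" for i
    using P_trail[OF that] P_avoids[OF that] arc_nth[OF that] nth_mem[OF that] that
    by (auto simp: Q_def u_def trail_Cons_iff)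
  have "disjoint_family_on (\<lambda>i. set (P i)) {..<length es}"
    using P by (simp add: arc_disjoint_trails_def)
  then have Q_disjoint: "disjoint_family_on (\<lambda>i. set (Q i)) {..<length es}"
  proof (rule disjoint_family_on_bisimulation)
    fix m n
    assume "m \<in> {..<length es}" "n \<in> {..<length es}" "m \<noteq> n" "set (P m) \<inter> set (P n) = {}"
    then show "set (Q m) \<inter> set (Q n) = {}"
      using P_avoids[of m] P_avoids[of n] nth_mem[of m es] nth_mem[of n es] es(2)
      by (auto simp: Q_def nth_eq_iff_index_eq)
  qed
  have "u 0 \<in> verts G"
    using es(1) arc_nth[of 0] by (simp add: u_def)
  with Q_trail Q_disjoint
  have "trail (u 0) (concat (map Q [0..<length es])) (u (length es))"
    by (rule trail_concat)
  then have "tour (concat (map Q [0..<length es]))"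
    by (auto simp: tour_def u_def)
  moreover have "subseq (map ((!) es) [0..<length es]) (concat (map Q [0..<length es]))"
    by (rule subseq_map_concat_map) (simp add: Q_def)
  ultimately show ?thesis
    by (auto simp: map_nth)
qed

end

context fin_digraph
begin

text \<open>
  The arc is taken inside a minimal tight set crossing \<open>R j\<close>: a tight set that blocks it could be
  uncrossed to a smaller one.
\<close>

lemma cut_condition_augmenting_arc:
  assumes "finite I" "A \<subseteq> arcs G" "cut_condition A I R" "j \<in> I" "\<not> verts G \<subseteq> R j"
  obtains e where "e \<in> A" "tail G e \<in> R j"
    "cut_condition (A - {e}) I (R(j := insert (head G e) (R j)))"
proof -
  have "finite A"
    using \<open>A \<subseteq> arcs G\<close> finite_arcs finite_subset by blast
  define crossing_tight where
    "crossing_tight = {X. X \<subseteq> verts G \<and> tight A I R X \<and> X \<inter> R j \<noteq> {} \<and> X - R j \<noteq> {}}"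
  have "verts G \<noteq> {}"
    using \<open>\<not> verts G \<subseteq> R j\<close> by blast
  then have "missed I R (verts G) = {}" "tight A I R (verts G)"
    using assms(1-3) by (simp_all add: missed_verts_empty tight_verts)
  then have "verts G \<in> crossing_tight"
    using \<open>j \<in> I\<close> \<open>\<not> verts G \<subseteq> R j\<close> by (auto simp: crossing_tight_def missed_def)
  moreover have "finite crossing_tight"
    by (rule finite_subset[of _ "Pow (verts G)"]) (auto simp: crossing_tight_def)
  ultimately obtain X where X: "X \<in> crossing_tight"
    and X_minimal: "\<And>Y. Y \<in> crossing_tight \<Longrightarrow> Y \<subseteq> X \<Longrightarrow> X = Y"
    using finite_has_minimal[of crossing_tight] by blast
  then obtain e where e: "e \<in> A" "tail G e \<in> X \<inter> R j" "head G e \<in> X - R j"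
    using tight_imp_arc_leaving_root[OF \<open>finite I\<close> \<open>finite A\<close> assms(3,4), of X]
    by (auto simp: crossing_tight_def)
  have "\<not> tight A I R Y" if "Y \<subseteq> verts G" "e \<in> entering A Y" "Y \<inter> R j \<noteq> {}" for Y
  proof
    assume "tight A I R Y"
    have e_enters: "tail G e \<notin> Y" "head G e \<in> X \<inter> Y - R j"
      using e \<open>e \<in> entering A Y\<close> by (auto simp: entering_def)
    then have "tight A I R (X \<inter> Y)" "missed I R (X \<inter> Y) = missed I R X \<union> missed I R Y"
      using tight_Int[OF \<open>finite I\<close> \<open>finite A\<close> assms(3), of X Y] X that \<open>tight A I R Y\<close>
      by (auto simp: crossing_tight_def)
    moreover have "j \<notin> missed I R X \<union> missed I R Y"
      using X that by (auto simp: crossing_tight_def missed_def)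
    ultimately have "X \<inter> Y \<in> crossing_tight"
      using \<open>j \<in> I\<close> that e_enters by (auto simp: crossing_tight_def missed_def)
    then show False
      using X_minimal[of "X \<inter> Y"] e e_enters by blast
  qed
  then have "cut_condition (A - {e}) I (R(j := insert (head G e) (R j)))"
    by (rule cut_condition_insert_head[OF \<open>finite I\<close> \<open>finite A\<close> assms(3,4)])
  with e show ?thesis
    by (intro that[of e]) auto
qed

theorem edmonds_disjoint_branchings:
  assumes "finite I" "A \<subseteq> arcs G" "cut_condition A I R"
  shows "\<exists>F. (\<forall>i\<in>I. F i \<subseteq> A \<and> spans_from (F i) (R i)) \<and> disjoint_family_on F I"
proof -
  have "finite A"
    using \<open>A \<subseteq> arcs G\<close> finite_arcs finite_subset by blast
  then show ?thesis
    using assms(2,3)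
  proof (induction A arbitrary: R rule: finite_psubset_induct)
    case (psubset A)
    show ?case
    proof (cases "\<forall>i\<in>I. verts G \<subseteq> R i")
      case True
      then show ?thesis
        by (intro exI[of _ "\<lambda>_. {}"]) (simp add: spans_from_verts disjoint_family_on_def)
    next
      case False
      then obtain j where "j \<in> I" "\<not> verts G \<subseteq> R j"
        by blast
      then obtain e where e: "e \<in> A" "tail G e \<in> R j"
        and cut: "cut_condition (A - {e}) I (R(j := insert (head G e) (R j)))"
        by (rule cut_condition_augmenting_arc[OF \<open>finite I\<close> psubset.prems])
      have "A - {e} \<subset> A" "A - {e} \<subseteq> arcs G"
        using e(1) psubset.prems(1) by auto
      then obtain F where F: "\<And>i. i \<in> I \<Longrightarrow> F i \<subseteq> A - {e}" "disjoint_family_on F I"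
        and spans: "\<And>i. i \<in> I \<Longrightarrow> spans_from (F i) ((R(j := insert (head G e) (R j))) i)"
        using psubset.IH[OF _ _ cut] by blast
      let ?F = "F(j := insert e (F j))"
      have "?F i \<subseteq> A" if "i \<in> I" for i
        using F(1)[OF that] e(1) by auto
      moreover have "spans_from (?F i) (R i)" if "i \<in> I" for i
        using spans[OF that] e psubset.prems(1)
        by (cases "i = j") (auto intro: spans_from_insert_head)
      moreover have "disjoint_family_on ?F I"
        using F by (intro disjoint_family_on_fun_upd_insert) blast+
      ultimately show ?thesis
        by blast
    qed
  qed
qed

theorem shiloach_weak_linkage:
  assumes "finite I" "A \<subseteq> arcs G" "s ` I \<subseteq> verts G" "t ` I \<subseteq> verts G"
    and "\<And>X. X \<noteq> {} \<Longrightarrow> X \<subset> verts G \<Longrightarrow> card I \<le> card (entering A X)"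
  shows "\<exists>P. arc_disjoint_trails A I s t P"
proof -
  have cut: "cut_condition A I (\<lambda>i. {s i})"
    by (rule cut_condition_singleton_roots[OF assms(1,3,5)])
  obtain F where F: "\<And>i. i \<in> I \<Longrightarrow> F i \<subseteq> A" "disjoint_family_on F I"
    and spans: "\<And>i. i \<in> I \<Longrightarrow> spans_from (F i) {s i}"
    using edmonds_disjoint_branchings[OF assms(1,2) cut] by blast
  have "\<exists>p. trail (s i) p (t i) \<and> set p \<subseteq> F i" if "i \<in> I" for i
  proof -
    have "t i \<in> verts G"
      using \<open>t ` I \<subseteq> verts G\<close> that by blast
    then obtain p where "awalk (s i) p (t i)" "set p \<subseteq> F i"
      using spans[OF \<open>i \<in> I\<close>] by (auto simp: spans_from_def)
    then show ?thesis
      by (metis awalk_imp_trail subset_trans)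
  qed
  then obtain P where P: "\<And>i. i \<in> I \<Longrightarrow> trail (s i) (P i) (t i) \<and> set (P i) \<subseteq> F i"
    by metis
  moreover have "disjoint_family_on (\<lambda>i. set (P i)) I"
    using F(2)
  proof (rule disjoint_family_on_bisimulation)
    fix m n assume "m \<in> I" "n \<in> I" "F m \<inter> F n = {}"
    then show "set (P m) \<inter> set (P n) = {}"
      using P[of m] P[of n] by blast
  qed
  ultimately show ?thesis
    using F(1) by (fastforce simp: arc_disjoint_trails_def)
qed

theorem edge_connected_imp_edge_ordered:
  assumes "edge_connected c" "2 * k \<le> c" "k \<ge> 1"
  shows "edge_ordered k"
  unfolding edge_ordered_def
proof (intro allI impI, elim conjE)
  fix es assume es: "length es = k" "distinct es" "set es \<subseteq> arcs G"
  have cut: "card {..<k} \<le> card (entering (arcs G - set es) X)"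
    if "X \<noteq> {}" "X \<subset> verts G" for X
    using card_entering_Diff_ge[OF \<open>edge_connected c\<close> _ that, of "set es"] es assms(2)
    by (simp add: distinct_card)
  have "es ! i \<in> arcs G" if "i < k" for i
    using nth_mem[of i es] es that by blast
  then have "(\<lambda>i. head G (es ! i)) ` {..<k} \<subseteq> verts G"
    and "(\<lambda>i. tail G (es ! (Suc i mod k))) ` {..<k} \<subseteq> verts G"
    using \<open>k \<ge> 1\<close> by auto
  then obtain P where "arc_disjoint_trails (arcs G - set es) {..<k}
      (\<lambda>i. head G (es ! i)) (\<lambda>i. tail G (es ! (Suc i mod k))) P"
    using shiloach_weak_linkage[OF finite_lessThan Diff_subset _ _ cut] by blast
  moreover have "es \<noteq> []"
    using es(1) \<open>k \<ge> 1\<close> by auto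
  ultimately obtain p where "tour p" "subseq es (rotate 0 p)"
    using tour_through_arcs[of es P] es by auto
  then show "\<exists>p. tour p \<and> (\<exists>r. subseq es (rotate r p))"
    by blast
qed

end

theorem theorem7p1:
  fixes D :: "('a, 'b) pre_digraph" and k d c :: nat
  assumes "k \<ge> 1" and "d \<ge> 1"
    and "int c \<ge> (2 * int k - 1) * \<lceil>real d / 2\<rceil> + 1"
    and "digraph D"
    and "pre_digraph.edge_connected D c"
    and "pre_digraph.diameter D = enat d"
  shows "pre_digraph.edge_ordered D k"
proof -
  interpret digraph D by fact
  have "1 \<le> \<lceil>real d / 2\<rceil>"
    using \<open>d \<ge> 1\<close> by (simp add: one_le_ceiling)
  then have "(2 * int k - 1) * 1 \<le> (2 * int k - 1) * \<lceil>real d / 2\<rceil>"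
    using \<open>k \<ge> 1\<close> by (intro mult_left_mono) auto
  then have "2 * int k \<le> int c"
    using assms(3) by simp
  then have "2 * k \<le> c"
    by linarith
  with \<open>edge_connected c\<close> show ?thesis
    using \<open>k \<ge> 1\<close> by (rule edge_connected_imp_edge_ordered)
qed

end
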